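(* For any fixed predictor $f\colon\mathscr{X}\to\mathbb{R}^L$, $$\mathbb{V}_{S\sim\mathbb{P}^N}\big[\hat R_*(f;S)\big]\;\le\;\mathbb{V}_{S\sim\mathbb{P}^N}\big[\hat R(f;S)\big],$$ where $\mathbb{V}$ denotes variance, $\hat R_*$ is the Bayes-distilled empirical risk and $\hat R$ is the standard (one-hot) empirical risk. Moreover, equality holds if and only if, for all $x\in\mathscr{X}$, the loss values $\ell(f(x))$ are constant on the support of $p^*(x)$, i.e. $\ell(y,f(x))$ takes the same value for all labels $y$ in the support of $p^*(x)$.
   Context: $[L]=\{1,\dots,L\}$ is the finite label set, $\mathscr{X}$ is the instance space, and $\mathbb{P}$ is a probability distribution on $\mathscr{X}\times[L]$. $S=\{(x_n,y_n)\}_{n=1}^N\sim\mathbb{P}^N$ is a training sample of $N$ independent draws from $\mathbb{P}$. $\ell\colon[L]\times\mathbb{R}^L\to\mathbb{R}_+$ is a loss function, and $\ell(f(x))=(\ell(1,f(x)),\dots,\ell(L,f(x)))\in\mathbb{R}_+^L$ is the vector of losses for each possible label. The Bayes class-probability distribution is $p^*(x)=(\mathbb{P}(y\mid x))_{y\in[L]}$, a probability vector in $\mathbb{R}^L$; its support is $\{y\in[L]:\mathbb{P}(y\mid x)>0\}$. Standard empirical risk: $\hat R(f;S)=\frac1N\sum_{n=1}^N \ell(y_n,f(x_n))$. Bayes-distilled empirical risk: $\hat R_*(f;S)=\frac1N\sum_{n=1}^N p^*(x_n)^{\mathrm T}\ell(f(x_n))$.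
   Formalization: In the equality condition, "for all x" is read as "for almost every x under the marginal of P", and the equality characterization is stated only when the variance of the Bayes-distilled risk is finite; the literal "only if" fails otherwise. *)

theory Defs
  imports "HOL-Probability.Probability"
begin

text \<open>
  The label set \<open>[L]\<close> is a finite index type \<open>'l\<close> with \<open>L = CARD('l)\<close>, so that
  \<open>\<real>\<^sup>L\<close> is \<^typ>\<open>real^'l\<close>. A sample \<open>S\<close> is a function on the indices \<open>{1..N}\<close>,
  with \<open>S n = (x\<^sub>n, y\<^sub>n)\<close>.
\<close>

definition loss_vec :: "('l::finite \<Rightarrow> real^'l \<Rightarrow> real) \<Rightarrow> real^'l \<Rightarrow> real^'l" where
  "loss_vec loss v = (\<chi> y. loss y v)"

definition emp_risk ::
  "nat \<Rightarrow> ('l::finite \<Rightarrow> real^'l \<Rightarrow> real) \<Rightarrow> ('x \<Rightarrow> real^'l) \<Rightarrow> (nat \<Rightarrow> 'x \<times> 'l) \<Rightarrow> real" where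
  "emp_risk N loss f S = 1 / real N * (\<Sum>n=1..N. loss (snd (S n)) (f (fst (S n))))"

definition bayes_emp_risk ::
  "nat \<Rightarrow> ('x \<Rightarrow> real^'l) \<Rightarrow> ('l::finite \<Rightarrow> real^'l \<Rightarrow> real) \<Rightarrow> ('x \<Rightarrow> real^'l)
    \<Rightarrow> (nat \<Rightarrow> 'x \<times> 'l) \<Rightarrow> real" where
  "bayes_emp_risk N p loss f S =
     1 / real N * (\<Sum>n=1..N. p (fst (S n)) \<bullet> loss_vec loss (f (fst (S n))))"

text \<open>
  \<open>p\<close> is a version of the class probabilities \<open>x \<mapsto> (P(y | x))\<^sub>y\<close>: a regular
  conditional distribution of the label given the instance. Versions are unique only up to
  null sets of the instance marginal \<open>distr P X fst\<close>.
\<close>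

definition bayes_class_prob ::
  "'x measure \<Rightarrow> ('x \<times> 'l::finite) measure \<Rightarrow> ('x \<Rightarrow> real^'l) \<Rightarrow> bool" where
  "bayes_class_prob X P p \<longleftrightarrow>
     (\<forall>y. (\<lambda>x. p x $ y) \<in> borel_measurable X) \<and>
     (\<forall>x\<in>space X. (\<forall>y. 0 \<le> p x $ y) \<and> (\<Sum>y\<in>UNIV. p x $ y) = 1) \<and>
     (\<forall>A\<in>sets X. \<forall>y. emeasure P (A \<times> {y}) = (\<integral>\<^sup>+x\<in>A. ennreal (p x $ y) \<partial>distr P X fst))"

definition label_support :: "real^'l::finite \<Rightarrow> 'l set" where
  "label_support q = {y. 0 < q $ y}"

text \<open>
  Variance with values in \<open>[0, \<infinity>]\<close>. The variance of the library is a Bochner integral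
  and hence \<open>0\<close> for variables that are not square integrable; here these get \<open>\<infinity>\<close>.
  The two lemmas below establish that this is the only difference.
\<close>

definition ext_variance :: "'a measure \<Rightarrow> ('a \<Rightarrow> real) \<Rightarrow> ennreal" where
  "ext_variance M Z = (\<integral>\<^sup>+\<omega>. ennreal ((Z \<omega> - integral\<^sup>L M Z)\<^sup>2) \<partial>M)"

lemma (in prob_space) ext_variance_eq_variance:
  assumes [measurable]: "Z \<in> borel_measurable M" and sq: "integrable M (\<lambda>\<omega>. (Z \<omega>)\<^sup>2)"
  shows "ext_variance M Z = ennreal (variance Z)"
proof -
  have "integrable M Z"
    using sq by (rule square_integrable_imp_integrable[rotated]) simp
  with sq have "integrable M (\<lambda>\<omega>. (Z \<omega> - expectation Z)\<^sup>2)"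
    by (simp add: power2_diff)
  then show ?thesis
    unfolding ext_variance_def by (rule nn_integral_eq_integral) simp
qed

lemma (in prob_space) ext_variance_eq_top:
  assumes [measurable]: "Z \<in> borel_measurable M" and nsq: "\<not> integrable M (\<lambda>\<omega>. (Z \<omega>)\<^sup>2)"
  shows "ext_variance M Z = \<infinity>"
proof (rule ccontr)
  define c where "c = expectation Z"
  assume "ext_variance M Z \<noteq> \<infinity>"
  then have sq: "integrable M (\<lambda>\<omega>. (Z \<omega> - c)\<^sup>2)"
    by (intro integrableI_nonneg) (auto simp: ext_variance_def c_def less_top)
  then have "integrable M (\<lambda>\<omega>. Z \<omega> - c)"
    by (rule square_integrable_imp_integrable[rotated]) simp
  with sq have "integrable M (\<lambda>\<omega>. (Z \<omega> - c)\<^sup>2 + 2 * c * (Z \<omega> - c) + c\<^sup>2)"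
    by simp
  also have "(\<lambda>\<omega>. (Z \<omega> - c)\<^sup>2 + 2 * c * (Z \<omega> - c) + c\<^sup>2) = (\<lambda>\<omega>. (Z \<omega>)\<^sup>2)"
    by (auto simp: power2_eq_square algebra_simps)
  finally show False
    using nsq by simp
qed

end

theory Submission
  imports Defs
begin

text \<open>
  Since the losses are nonnegative, the variance of an average of \<open>N\<close> independent copies is
  \<open>1/N\<close> times the variance of a single copy, also when it is infinite. This
  reduces the claim to \<open>N = 1\<close>. There \<open>loss y (f x)\<close> and its conditional mean
  \<open>p x \<bullet> loss_vec loss (f x)\<close> have the same expectation, and the bias-variance
  decomposition under each \<open>p x\<close> shows that the two variances differ by the
  integral over \<open>x\<close> of the conditional variance of the loss given \<open>x\<close>. This
  integral vanishes iff the conditional variance vanishes almost everywhere, which is constancy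
  on the support.
\<close>

section \<open>Variance of an average of independent copies\<close>

text \<open>Expanding the square gives a double sum over pairs of coordinates. By independence and
  \<open>mean\<close>, the off-diagonal pairs integrate to 0, and each of the \<open>card I\<close>
  diagonal ones contributes the second moment of \<open>g\<close>.\<close>

lemma has_bochner_integral_PiM_sum_squared:
  fixes g :: "'a \<Rightarrow> real"
  assumes "prob_space M" "finite I" and int: "integrable M g" and mean: "integral\<^sup>L M g = 0"
    and sq: "integrable M (\<lambda>x. (g x)\<^sup>2)"
  shows "has_bochner_integral (PiM I (\<lambda>_. M)) (\<lambda>S. (\<Sum>i\<in>I. g (S i))\<^sup>2)
           (real (card I) * (\<integral>x. (g x)\<^sup>2 \<partial>M))"
proof -
  interpret M: prob_space M by fact
  interpret product_prob_space "\<lambda>_. M" by unfold_locales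
  let ?v = "\<integral>x. (g x)\<^sup>2 \<partial>M"
  have "has_bochner_integral (PiM I (\<lambda>_. M)) (\<lambda>S. g (S i) * g (S j)) (if i = j then ?v else 0)"
    if ij: "i \<in> I" "j \<in> I" for i j
  proof -
    \<comment> \<open>One factor per coordinate, so that the product formula for integrals over
      \<open>PiM\<close> handles both kinds of pairs: for \<open>i = j\<close> the factor at
      \<open>i\<close> is the square of \<open>g\<close>, for distinct indices \<open>g\<close>
      occurs at both, and elsewhere the factor is 1.\<close>
    define h where "h k x = (if k = i then g x else 1) * (if k = j then g x else 1)" for k x
    have h: "integrable M (h k)" for k
      using int sq unfolding h_def by (cases "k = i"; cases "k = j") (auto simp: power2_eq_square)
    have prod_h: "(\<Prod>k\<in>I. h k (S k)) = g (S i) * g (S j)" for S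
      using ij \<open>finite I\<close> by (simp add: h_def prod.distrib)
    have prod_int: "(\<Prod>k\<in>I. integral\<^sup>L M (h k)) = (if i = j then ?v else 0)"
    proof (cases "i = j")
      case True
      then have "(\<Prod>k\<in>I. integral\<^sup>L M (h k)) = (\<Prod>k\<in>I. if k = i then ?v else 1)"
        by (intro prod.cong) (auto simp: h_def[abs_def] power2_eq_square M.prob_space)
      with True ij \<open>finite I\<close> show ?thesis by simp
    next
      case False
      then have "integral\<^sup>L M (h i) = 0"
        by (simp add: h_def[abs_def] mean)
      with False ij \<open>finite I\<close> show ?thesis by auto
    qed
    show ?thesis
      using product_integral_prod[of I h] product_integrable_prod[of I h] \<open>finite I\<close> h
      unfolding prod_h prod_int by (simp add: has_bochner_integral_iff)
  qed
  then have "has_bochner_integral (PiM I (\<lambda>_. M)) (\<lambda>S. \<Sum>i\<in>I. \<Sum>j\<in>I. g (S i) * g (S j))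
      (\<Sum>i\<in>I. \<Sum>j\<in>I. if i = j then ?v else 0)"
    by (intro has_bochner_integral_sum)
  then show ?thesis
    using \<open>finite I\<close> by (simp add: power2_eq_square sum_product)
qed

lemma ext_variance_average:
  fixes Z :: "'a \<Rightarrow> real"
  assumes "prob_space M" and [measurable]: "Z \<in> borel_measurable M"
    and nonneg: "\<And>z. z \<in> space M \<Longrightarrow> 0 \<le> Z z" and "1 \<le> N"
  shows "ext_variance (PiM {1..N} (\<lambda>_. M)) (\<lambda>S. 1 / real N * (\<Sum>n=1..N. Z (S n)))
           = ennreal (1 / real N) * ext_variance M Z"
proof -
  interpret M: prob_space M by fact
  interpret PP: product_prob_space "\<lambda>_. M" "{1..N}" by unfold_locales
  let ?P = "PiM {1..N} (\<lambda>_. M)"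
  define A where "A S = 1 / real N * (\<Sum>n=1..N. Z (S n))" for S
  have coord: "distr ?P M (\<lambda>S. S n) = M" if "n \<in> {1..N}" for n
    using that by (intro distr_PiM_component M.prob_space_axioms)
  have meas_A[measurable]: "A \<in> borel_measurable ?P"
    unfolding A_def by measurable
  have "ext_variance ?P A = ennreal (1 / real N) * ext_variance M Z"
  proof (cases "integrable M (\<lambda>z. (Z z)\<^sup>2)")
    case True
    then have int: "integrable M Z"
      by (rule M.square_integrable_imp_integrable[rotated]) simp
    let ?g = "\<lambda>z. Z z - M.expectation Z"
    let ?v = "\<integral>z. (?g z)\<^sup>2 \<partial>M"
    have sq: "integrable M (\<lambda>z. (?g z)\<^sup>2)"
      using True int by (simp add: power2_diff)
    have "integrable ?P (\<lambda>S. Z (S n)) \<and> (\<integral>S. Z (S n) \<partial>?P) = M.expectation Z" if "n \<in> {1..N}" for n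
      using integrable_distr_eq[of "\<lambda>S. S n" ?P M Z] integral_distr[of "\<lambda>S. S n" ?P M Z]
        coord[OF that] that int by simp
    then have mean: "integral\<^sup>L ?P A = M.expectation Z"
      using \<open>1 \<le> N\<close> unfolding A_def by (subst integral_mult_right_zero, subst Bochner_Integration.integral_sum) auto
    have dev: "A S - M.expectation Z = 1 / real N * (\<Sum>n=1..N. ?g (S n))" for S
      using \<open>1 \<le> N\<close> by (simp add: A_def sum_subtractf field_simps)
    \<comment> \<open>The prefactor is squared while the centred sum contributes only
      \<open>N\<close> diagonal terms, which leaves \<open>1 / N\<close>.\<close>
    have "has_bochner_integral ?P (\<lambda>S. (1 / real N)\<^sup>2 * (\<Sum>n=1..N. ?g (S n))\<^sup>2)
        ((1 / real N)\<^sup>2 * (real (card {1..N}) * ?v))"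
      using int sq by (intro has_bochner_integral_mult_right has_bochner_integral_PiM_sum_squared M.prob_space_axioms)
        (simp_all add: M.prob_space)
    then have *: "has_bochner_integral ?P (\<lambda>S. (A S - integral\<^sup>L ?P A)\<^sup>2) (1 / real N * ?v)"
      unfolding mean dev power_mult_distrib using \<open>1 \<le> N\<close> by (simp add: power2_eq_square)
    have "ext_variance ?P A = ennreal (1 / real N * ?v)"
      using * unfolding ext_variance_def has_bochner_integral_iff
      by (subst nn_integral_eq_integral) auto
    also have "\<dots> = ennreal (1 / real N) * ext_variance M Z"
      unfolding M.ext_variance_eq_variance[OF assms(2) True] by (rule ennreal_mult) simp_all
    finally show ?thesis .
  next
    case False
    \<comment> \<open>Nonnegative summands cannot cancel, so \<open>Z (S 1)\<close> is at most
      \<open>N\<close> times the average. Square integrability of the average would pass to this one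
      coordinate, whose law is \<open>M\<close>.\<close>
    have "\<not> integrable ?P (\<lambda>S. (A S)\<^sup>2)"
    proof
      assume "integrable ?P (\<lambda>S. (A S)\<^sup>2)"
      then have "integrable ?P (\<lambda>S. (real N)\<^sup>2 * (A S)\<^sup>2)"
        by simp
      moreover have "(Z (S 1))\<^sup>2 \<le> (real N)\<^sup>2 * (A S)\<^sup>2" if "S \<in> space ?P" for S
      proof -
        have pos: "0 \<le> Z (S n)" if "n \<in> {1..N}" for n
          using \<open>S \<in> space ?P\<close> that by (intro nonneg) (auto simp: space_PiM)
        have "Z (S 1) \<le> (\<Sum>n=1..N. Z (S n))"
          using \<open>1 \<le> N\<close> pos by (intro member_le_sum) auto
        also have "\<dots> = real N * A S"
          using \<open>1 \<le> N\<close> by (simp add: A_def)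
        finally have "(Z (S 1))\<^sup>2 \<le> (real N * A S)\<^sup>2"
          using pos[of 1] \<open>1 \<le> N\<close> by (intro power_mono) auto
        then show ?thesis
          by (simp add: power_mult_distrib)
      qed
      moreover have "(\<lambda>S. (Z (S 1))\<^sup>2) \<in> borel_measurable ?P"
        using \<open>1 \<le> N\<close> by (intro measurable_PiM_component_rev) auto
      ultimately have "integrable ?P (\<lambda>S. (Z (S 1))\<^sup>2)"
        by (elim Bochner_Integration.integrable_bound) (auto intro!: AE_I2)
      then have "integrable (distr ?P M (\<lambda>S. S 1)) (\<lambda>z. (Z z)\<^sup>2)"
        using \<open>1 \<le> N\<close> by (subst integrable_distr_eq) auto
      then show False
        using False coord[of 1] \<open>1 \<le> N\<close> by simp
    qed
    then have "ext_variance ?P A = \<infinity>"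
      by (intro PP.ext_variance_eq_top meas_A)
    moreover have "ext_variance M Z = \<infinity>"
      using False by (intro M.ext_variance_eq_top assms)
    ultimately show ?thesis
      using \<open>1 \<le> N\<close> by (simp add: ennreal_mult_top)
  qed
  then show ?thesis
    by (simp add: A_def[abs_def])
qed

section \<open>Conditioning on the instance\<close>

text \<open>There are finitely many labels, so \<open>P\<close> splits into its restrictions to the
  slices \<open>space X \<times> {y}\<close>. By \<open>bayes_class_prob\<close>, the projection of
  such a slice to \<open>X\<close> has density \<open>p x $ y\<close> with respect to the instance
  marginal.\<close>

lemma nn_integral_bayes_class_prob:
  fixes P :: "('x \<times> 'l::finite) measure" and g :: "'x \<times> 'l \<Rightarrow> ennreal"
  assumes sets_P: "sets P = sets (X \<Otimes>\<^sub>M count_space UNIV)" and bayes: "bayes_class_prob X P p"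
    and [measurable]: "\<And>y. (\<lambda>x. g (x, y)) \<in> borel_measurable X"
  shows "(\<integral>\<^sup>+z. g z \<partial>P) = (\<integral>\<^sup>+x. (\<Sum>y\<in>UNIV. ennreal (p x $ y) * g (x, y)) \<partial>distr P X fst)"
proof -
  let ?\<mu> = "distr P X fst"
  note [measurable_cong] = sets_P
  have [measurable]: "\<And>y. (\<lambda>x. p x $ y) \<in> borel_measurable X"
    using bayes by (simp add: bayes_class_prob_def)
  have fst_P: "fst \<in> measurable P X"
    by measurable
  have slice: "(\<integral>\<^sup>+z. indicator (space X \<times> {y}) z * g (fst z, y) \<partial>P)
      = (\<integral>\<^sup>+x. ennreal (p x $ y) * g (x, y) \<partial>?\<mu>)" for y
  proof -
    have "distr (density P (indicator (space X \<times> {y}))) X fst = density ?\<mu> (\<lambda>x. ennreal (p x $ y))"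
    proof (rule measure_eqI)
      fix A assume "A \<in> sets (distr (density P (indicator (space X \<times> {y}))) X fst)"
      then have A[measurable]: "A \<in> sets X" by simp
      have space: "space P = space X \<times> UNIV"
        using sets_eq_imp_space_eq[OF sets_P] by (simp add: space_pair_measure)
      have "emeasure (distr (density P (indicator (space X \<times> {y}))) X fst) A
          = emeasure (density P (indicator (space X \<times> {y}))) (fst -` A \<inter> space P)"
        by (subst emeasure_distr) auto
      also have "\<dots> = emeasure P ((space X \<times> {y}) \<inter> (fst -` A \<inter> space P))"
        by (rule emeasure_restricted) (simp add: sets_P, rule measurable_sets[OF fst_P A])
      also have "(space X \<times> {y}) \<inter> (fst -` A \<inter> space P) = A \<times> {y}"
        using sets.sets_into_space[OF A] by (auto simp: space)
      also have "emeasure P (A \<times> {y}) = (\<integral>\<^sup>+x\<in>A. ennreal (p x $ y) \<partial>?\<mu>)"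
        using bayes A by (simp add: bayes_class_prob_def)
      also have "\<dots> = emeasure (density ?\<mu> (\<lambda>x. ennreal (p x $ y))) A"
        by (subst emeasure_density) auto
      finally show "emeasure (distr (density P (indicator (space X \<times> {y}))) X fst) A
          = emeasure (density ?\<mu> (\<lambda>x. ennreal (p x $ y))) A" .
    qed simp
    then have "(\<integral>\<^sup>+x. g (x, y) \<partial>distr (density P (indicator (space X \<times> {y}))) X fst)
        = (\<integral>\<^sup>+x. g (x, y) \<partial>density ?\<mu> (\<lambda>x. ennreal (p x $ y)))"
      by simp
    then show ?thesis
      by (simp add: nn_integral_distr nn_integral_density)
  qed
  \<comment> \<open>Each \<open>z\<close> lies in exactly one slice, where \<open>y = snd z\<close>.
    Writing \<open>g (fst z, y)\<close> with \<open>y\<close> fixed makes each summand a function of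
    the instance on its slice, as \<open>slice\<close> requires.\<close>
  have "(\<integral>\<^sup>+z. g z \<partial>P) = (\<integral>\<^sup>+z. (\<Sum>y\<in>UNIV. indicator (space X \<times> {y}) z * g (fst z, y)) \<partial>P)"
  proof (rule nn_integral_cong)
    fix z assume "z \<in> space P"
    then have z: "fst z \<in> space X"
      using sets_eq_imp_space_eq[OF sets_P] by (auto simp: space_pair_measure)
    have "(\<Sum>y\<in>UNIV. indicator (space X \<times> {y}) z * g (fst z, y))
        = (\<Sum>y\<in>UNIV. if y = snd z then g z else 0)"
      using z by (cases z) (auto simp: indicator_def intro!: sum.cong)
    then show "g z = (\<Sum>y\<in>UNIV. indicator (space X \<times> {y}) z * g (fst z, y))"
      by simp
  qed
  also have "\<dots> = (\<Sum>y\<in>UNIV. \<integral>\<^sup>+z. indicator (space X \<times> {y}) z * g (fst z, y) \<partial>P)"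
    by (rule nn_integral_sum) measurable
  also have "\<dots> = (\<integral>\<^sup>+x. (\<Sum>y\<in>UNIV. ennreal (p x $ y) * g (x, y)) \<partial>?\<mu>)"
    unfolding slice by (rule nn_integral_sum[symmetric]) measurable
  finally show ?thesis .
qed

section \<open>Bias-variance decomposition over the labels\<close>

text \<open>For weights of total 1, the weighted squared deviation from any centre \<open>c\<close>
  depends only on the second moment, the mean and \<open>c\<close>. Comparing the centres
  \<open>m\<close> and the weighted mean gives the identity.\<close>

lemma weighted_sum_square_dev:
  fixes q l :: "'a \<Rightarrow> real"
  assumes "(\<Sum>y\<in>I. q y) = 1"
  shows "(\<Sum>y\<in>I. q y * (l y - m)\<^sup>2)
    = ((\<Sum>y\<in>I. q y * l y) - m)\<^sup>2 + (\<Sum>y\<in>I. q y * (l y - (\<Sum>y\<in>I. q y * l y))\<^sup>2)"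
proof -
  let ?w = "\<Sum>y\<in>I. q y * l y"
  have expand: "(\<Sum>y\<in>I. q y * (l y - c)\<^sup>2) = (\<Sum>y\<in>I. q y * (l y)\<^sup>2) - 2 * c * ?w + c\<^sup>2" for c
  proof -
    have "(\<Sum>y\<in>I. q y * (l y - c)\<^sup>2)
        = (\<Sum>y\<in>I. q y * (l y)\<^sup>2 - 2 * c * (q y * l y) + c\<^sup>2 * q y)"
      by (intro sum.cong) (auto simp: power2_eq_square algebra_simps)
    also have "\<dots> = (\<Sum>y\<in>I. q y * (l y)\<^sup>2) - 2 * c * ?w + c\<^sup>2 * (\<Sum>y\<in>I. q y)"
      by (simp add: sum.distrib sum_subtractf sum_distrib_left)
    finally show ?thesis using assms by simp
  qed
  show ?thesis
    unfolding expand by (simp add: power2_eq_square algebra_simps)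
qed

lemma weighted_variance_eq_0_iff:
  fixes q :: "real^'l::finite" and l :: "'l \<Rightarrow> real"
  assumes nonneg: "\<And>y. 0 \<le> q $ y" and total: "(\<Sum>y\<in>UNIV. q $ y) = 1"
  shows "(\<Sum>y\<in>UNIV. q $ y * (l y - (\<Sum>y\<in>UNIV. q $ y * l y))\<^sup>2) = 0
    \<longleftrightarrow> l constant_on label_support q"
proof -
  let ?w = "\<Sum>y\<in>UNIV. q $ y * l y"
  have "(\<Sum>y\<in>UNIV. q $ y * (l y - ?w)\<^sup>2) = 0 \<longleftrightarrow> (\<forall>y. q $ y = 0 \<or> l y = ?w)"
    using nonneg by (subst sum_nonneg_eq_0_iff) auto
  also have "\<dots> \<longleftrightarrow> (\<forall>y\<in>label_support q. l y = ?w)"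
    using nonneg by (auto simp: label_support_def less_le)
  also have "\<dots> \<longleftrightarrow> l constant_on label_support q"
  proof
    assume "l constant_on label_support q"
    then obtain c where c: "\<And>y. y \<in> label_support q \<Longrightarrow> l y = c"
      by (auto simp: constant_on_def)
    \<comment> \<open>Off the support both sides are 0, so the weighted mean sees only the constant
      \<open>c\<close>.\<close>
    have "q $ y * l y = q $ y * c" for y
      using c[of y] nonneg[of y] by (cases "q $ y = 0") (auto simp: label_support_def less_le)
    then have "?w = (\<Sum>y\<in>UNIV. q $ y * c)"
      by (intro sum.cong) auto
    also have "\<dots> = c"
      using total by (simp flip: sum_distrib_right)
    finally show "\<forall>y\<in>label_support q. l y = ?w"
      using c by simp
  qed (auto simp: constant_on_def)
  finally show ?thesis .
qed

text \<open>The law of total variance: both variables have the same mean, and the decomposition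
  under each \<open>p x\<close> is integrated over the marginal. Its additive form in
  \<open>ennreal\<close> covers infinite variances too.\<close>

lemma ext_variance_bayes_decomposition:
  fixes P :: "('x \<times> 'l::finite) measure" and l :: "'x \<Rightarrow> 'l \<Rightarrow> real" and p :: "'x \<Rightarrow> real^'l"
  defines "w \<equiv> \<lambda>x. \<Sum>y\<in>UNIV. p x $ y * l x y"
  assumes sets_P: "sets P = sets (X \<Otimes>\<^sub>M count_space UNIV)" and bayes: "bayes_class_prob X P p"
    and nonneg: "\<And>x y. 0 \<le> l x y" and l[measurable]: "\<And>y. (\<lambda>x. l x y) \<in> borel_measurable X"
  shows "ext_variance P (\<lambda>z. l (fst z) (snd z)) = ext_variance P (\<lambda>z. w (fst z))
    + (\<integral>\<^sup>+x. ennreal (\<Sum>y\<in>UNIV. p x $ y * (l x y - w x)\<^sup>2) \<partial>distr P X fst)"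
proof -
  let ?\<mu> = "distr P X fst"
  note [measurable_cong] = sets_P
  have p[measurable]: "\<And>y. (\<lambda>x. p x $ y) \<in> borel_measurable X"
    and p_nonneg: "\<And>x y. x \<in> space X \<Longrightarrow> 0 \<le> p x $ y"
    and p_total: "\<And>x. x \<in> space X \<Longrightarrow> (\<Sum>y\<in>UNIV. p x $ y) = 1"
    using bayes by (auto simp: bayes_class_prob_def)
  have w[measurable]: "w \<in> borel_measurable X"
    unfolding w_def by measurable
  have l_P: "(\<lambda>z. l (fst z) (snd z)) \<in> borel_measurable P"
    by measurable
  have fst: "fst \<in> measurable P X"
    by measurable
  have cond: "(\<integral>\<^sup>+z. ennreal (h (fst z) (snd z)) \<partial>P)
      = (\<integral>\<^sup>+x. ennreal (\<Sum>y\<in>UNIV. p x $ y * h x y) \<partial>?\<mu>)"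
    if h: "\<And>x y. 0 \<le> h x y" "\<And>y. (\<lambda>x. h x y) \<in> borel_measurable X" for h
  proof -
    have "(\<integral>\<^sup>+z. ennreal (h (fst z) (snd z)) \<partial>P)
        = (\<integral>\<^sup>+x. (\<Sum>y\<in>UNIV. ennreal (p x $ y) * ennreal (h x y)) \<partial>?\<mu>)"
      using h by (subst nn_integral_bayes_class_prob[OF sets_P bayes]) auto
    also have "\<dots> = (\<integral>\<^sup>+x. ennreal (\<Sum>y\<in>UNIV. p x $ y * h x y) \<partial>?\<mu>)"
      using h p_nonneg by (intro nn_integral_cong) (simp add: ennreal_mult flip: sum_ennreal)
    finally show ?thesis .
  qed
  have marginal: "(\<integral>\<^sup>+z. k (fst z) \<partial>P) = (\<integral>\<^sup>+x. k x \<partial>?\<mu>)" if "k \<in> borel_measurable X" for k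
    using that fst by (simp add: nn_integral_distr)
  \<comment> \<open>Both variables are nonnegative with equal nonnegative integrals, so their
    Bochner integrals agree even if that common value is infinite; both are then 0 by
    default.\<close>
  have mean: "integral\<^sup>L P (\<lambda>z. l (fst z) (snd z)) = integral\<^sup>L P (\<lambda>z. w (fst z))"
  proof -
    have "AE z in P. 0 \<le> w (fst z)"
      using nonneg p_nonneg measurable_space[OF fst] by (auto simp: w_def intro!: sum_nonneg)
    then show ?thesis
      using nonneg l cond[of l] marginal[of "\<lambda>x. ennreal (w x)"] l_P
      by (subst (1 2) integral_eq_nn_integral) (auto simp: w_def)
  qed
  define m where "m = integral\<^sup>L P (\<lambda>z. w (fst z))"
  have "ext_variance P (\<lambda>z. l (fst z) (snd z)) = (\<integral>\<^sup>+z. ennreal ((l (fst z) (snd z) - m)\<^sup>2) \<partial>P)"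
    by (simp add: ext_variance_def mean m_def)
  also have "\<dots> = (\<integral>\<^sup>+x. ennreal (\<Sum>y\<in>UNIV. p x $ y * (l x y - m)\<^sup>2) \<partial>?\<mu>)"
    by (rule cond) auto
  also have "\<dots> = (\<integral>\<^sup>+x. ennreal ((w x - m)\<^sup>2)
      + ennreal (\<Sum>y\<in>UNIV. p x $ y * (l x y - w x)\<^sup>2) \<partial>?\<mu>)"
  proof (intro nn_integral_cong)
    fix x assume "x \<in> space ?\<mu>"
    then have x: "x \<in> space X" by simp
    have "0 \<le> (\<Sum>y\<in>UNIV. p x $ y * (l x y - w x)\<^sup>2)"
      using p_nonneg[OF x] by (intro sum_nonneg) auto
    then show "ennreal (\<Sum>y\<in>UNIV. p x $ y * (l x y - m)\<^sup>2)
        = ennreal ((w x - m)\<^sup>2) + ennreal (\<Sum>y\<in>UNIV. p x $ y * (l x y - w x)\<^sup>2)"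
      using weighted_sum_square_dev[OF p_total[OF x], of "l x" m]
      by (simp add: w_def ennreal_plus)
  qed
  also have "\<dots> = (\<integral>\<^sup>+x. ennreal ((w x - m)\<^sup>2) \<partial>?\<mu>)
      + (\<integral>\<^sup>+x. ennreal (\<Sum>y\<in>UNIV. p x $ y * (l x y - w x)\<^sup>2) \<partial>?\<mu>)"
    by (rule nn_integral_add) measurable
  also have "(\<integral>\<^sup>+x. ennreal ((w x - m)\<^sup>2) \<partial>?\<mu>) = ext_variance P (\<lambda>z. w (fst z))"
    unfolding ext_variance_def m_def by (rule marginal[symmetric]) measurable
  finally show ?thesis .
qed

section \<open>Comparison of the two empirical risks\<close>

text \<open>If the distilled variance is infinite, so is the other one, and equality says nothing
  about the losses; hence the finiteness premise of the equivalence. Constancy is asserted almost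
  everywhere because a null set of instances affects neither variance.\<close>

theorem lemma1:
  fixes X :: "'x measure" and P :: "('x \<times> 'l::finite) measure"
    and loss :: "'l \<Rightarrow> real^'l \<Rightarrow> real" and f p :: "'x \<Rightarrow> real^'l" and N :: nat
  assumes "prob_space P" and "sets P = sets (X \<Otimes>\<^sub>M count_space UNIV)"
    and "bayes_class_prob X P p"
    and "\<And>y v. 0 \<le> loss y v"
    and "\<And>y. (\<lambda>x. loss y (f x)) \<in> borel_measurable X"
    and "1 \<le> N"
  shows "ext_variance (PiM {1..N} (\<lambda>_. P)) (bayes_emp_risk N p loss f)
           \<le> ext_variance (PiM {1..N} (\<lambda>_. P)) (emp_risk N loss f) \<and>
         (ext_variance (PiM {1..N} (\<lambda>_. P)) (bayes_emp_risk N p loss f) < \<infinity> \<longrightarrow>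
          (ext_variance (PiM {1..N} (\<lambda>_. P)) (bayes_emp_risk N p loss f)
             = ext_variance (PiM {1..N} (\<lambda>_. P)) (emp_risk N loss f)
           \<longleftrightarrow> (AE x in distr P X fst. (\<lambda>y. loss y (f x)) constant_on label_support (p x))))"
proof -
  note [measurable_cong] = assms(2)
  note [measurable] = assms(5)
  let ?\<mu> = "distr P X fst"
  have p[measurable]: "\<And>y. (\<lambda>x. p x $ y) \<in> borel_measurable X"
    and p_nonneg: "\<And>x y. x \<in> space X \<Longrightarrow> 0 \<le> p x $ y"
    and p_total: "\<And>x. x \<in> space X \<Longrightarrow> (\<Sum>y\<in>UNIV. p x $ y) = 1"
    using assms(3) by (auto simp: bayes_class_prob_def)
  define w where "w x = (\<Sum>y\<in>UNIV. p x $ y * loss y (f x))" for x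
  define V where "V x = (\<Sum>y\<in>UNIV. p x $ y * (loss y (f x) - w x)\<^sup>2)" for x
  have w[measurable]: "w \<in> borel_measurable X"
    unfolding w_def by measurable
  have [measurable]: "V \<in> borel_measurable X"
    unfolding V_def by measurable
  have fst[measurable]: "fst \<in> measurable P X"
    by measurable

  have emp: "ext_variance (PiM {1..N} (\<lambda>_. P)) (emp_risk N loss f)
      = ennreal (1 / real N) * ext_variance P (\<lambda>z. loss (snd z) (f (fst z)))"
    unfolding emp_risk_def[abs_def] using assms(1,4,6) by (intro ext_variance_average) auto
  \<comment> \<open>The distilled risk is itself an average of independent copies, namely of
    \<open>w (fst z)\<close>, which ignores the label.\<close>
  have bayes_emp: "ext_variance (PiM {1..N} (\<lambda>_. P)) (bayes_emp_risk N p loss f)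
      = ennreal (1 / real N) * ext_variance P (\<lambda>z. w (fst z))"
  proof -
    have "bayes_emp_risk N p loss f = (\<lambda>S. 1 / real N * (\<Sum>n=1..N. w (fst (S n))))"
      by (auto simp: bayes_emp_risk_def w_def loss_vec_def inner_vec_def)
    moreover have "0 \<le> w (fst z)" if "z \<in> space P" for z
      using assms(4) p_nonneg measurable_space[OF fst that] by (auto simp: w_def intro!: sum_nonneg)
    ultimately show ?thesis
      using assms(1,6) by (simp only:) (rule ext_variance_average, simp_all)
  qed
  have dec: "ext_variance P (\<lambda>z. loss (snd z) (f (fst z)))
      = ext_variance P (\<lambda>z. w (fst z)) + (\<integral>\<^sup>+x. ennreal (V x) \<partial>?\<mu>)"
    using ext_variance_bayes_decomposition[OF assms(2,3), of "\<lambda>x y. loss y (f x)"] assms(4,5)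
    by (simp add: w_def V_def)
  have V_eq_0: "ennreal (V x) = 0 \<longleftrightarrow> (\<lambda>y. loss y (f x)) constant_on label_support (p x)"
    if x: "x \<in> space X" for x
  proof -
    have "0 \<le> V x"
      using p_nonneg[OF x] by (auto simp: V_def intro!: sum_nonneg)
    then have "ennreal (V x) = 0 \<longleftrightarrow> V x = 0"
      by simp
    also have "\<dots> \<longleftrightarrow> (\<lambda>y. loss y (f x)) constant_on label_support (p x)"
      unfolding V_def w_def using p_nonneg[OF x] p_total[OF x] by (rule weighted_variance_eq_0_iff)
    finally show ?thesis .
  qed
  have int_V: "(\<integral>\<^sup>+x. ennreal (V x) \<partial>?\<mu>) = 0
      \<longleftrightarrow> (AE x in ?\<mu>. (\<lambda>y. loss y (f x)) constant_on label_support (p x))"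
    by (subst nn_integral_0_iff_AE, simp, rule AE_cong) (simp add: V_eq_0)
  let ?c = "ennreal (1 / real N)"
  let ?w = "ext_variance P (\<lambda>z. w (fst z))" and ?V = "\<integral>\<^sup>+x. ennreal (V x) \<partial>?\<mu>"
  have c: "?c \<noteq> 0"
    using assms(6) by simp
  have sum: "?c * (?w + ?V) = ?c * ?w + ?c * ?V"
    by (rule distrib_left)
  \<comment> \<open>Cancellation in \<open>ennreal\<close> is valid only for a finite summand;
    afterwards \<open>?c \<noteq> 0\<close> removes the factor \<open>1 / N\<close>.\<close>
  have "?c * ?w = ?c * ?w + ?c * ?V \<longleftrightarrow> ?V = 0" if "?c * ?w < \<infinity>"
    using that c ennreal_add_left_cancel[of "?c * ?w" 0 "?c * ?V"] by auto
  then show ?thesis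
    unfolding emp bayes_emp dec sum int_V[symmetric] by auto
qed

end
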